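(* Let $V$ be a vector space over a field $\mathbb{K}$, $N\geq 1$, $F_1,\ldots,F_N$ endomorphisms of $V$ and $a=(a_1,\ldots,a_N)\in\mathbb{K}^N$. With the products $*$, $\bullet$ and the Lie bracket ${}_a[-,-]$ on $T(V)^N$ defined in the context, the following conditions are equivalent: 1. $(T(V)^N,\bullet)$ is a pre-Lie algebra. 2. $\mathfrak{g}'_a=(T(V)^N,{}_a[-,-],* )$ is a post-Lie algebra. 3. $V$ is a module over the Lie algebra $\mathfrak{g}_a$, with the action given by $\epsilon_i.v=F_i(v)$.
   Context: $(\epsilon_1,\ldots,\epsilon_N)$ is the canonical basis of $\mathbb{K}^N$. $T(V)$ is the space of tensors (words) on $V$, with empty word $\emptyset$ and shuffle product $sh$ (commutative, associative, unit $\emptyset$). Elements of $T(V)^N$ are written $f_1\epsilon_1+\ldots+f_N\epsilon_N$ with $f_i\in T(V)$; for $x\in V$, left concatenation by $x$ acts componentwise. The bilinear products below are defined for $f,g\in T(V)$, $x\in V$, $i,j\in\{1,\ldots,N\}$: - $*$, inductively: $\emptyset\epsilon_i*g\epsilon_j=0$ and $(xf)\epsilon_i*g\epsilon_j=x(f\epsilon_i*g\epsilon_j)+F_j(x)(f\,sh\,g)\epsilon_i$; - ${}_a sh$: $f\epsilon_i\;{}_a sh\;g\epsilon_j=a_i(f\,sh\,g)\epsilon_j$ (associative); - ${}_a[f\epsilon_i,g\epsilon_j]=(f\,sh\,g)(a_i\epsilon_j-a_j\epsilon_i)$, the commutator of ${}_a sh$; - $u\bullet v=u*v+u\;{}_a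 sh\;v$ for $u,v\in T(V)^N$. $\mathfrak{g}_a$ is the Lie algebra $\mathbb{K}^N$ with bracket $[\epsilon_i,\epsilon_j]_a=a_j\epsilon_i-a_i\epsilon_j$. A (right) pre-Lie algebra is a vector space with a bilinear product $\bullet$ such that $(x\bullet y)\bullet z-x\bullet(y\bullet z)=(x\bullet z)\bullet y-x\bullet(z\bullet y)$. A (right) post-Lie algebra is a triple $(\mathfrak{g},\{-,-\},* )$ where $(\mathfrak{g},\{-,-\})$ is a Lie algebra and $*$ is bilinear with $x*\{y,z\}=(x*y)*z-x*(y*z)-(x*z)*y+x*(z*y)$ and $\{x,y\}*z=\{x*z,y\}+\{x,y*z\}$. *)

theory Defs
  imports Complex_Main "HOL-Library.Poly_Mapping" "HOL-Algebra.Module"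
begin

section \<open>Algebras over a field\<close>

text \<open>A vector space is a record in the sense of HOL-Algebra, with the field \<open>K\<close> as a separate
  ring record; the fields \<open>mult\<close> and \<open>one\<close> of the record \<open>L\<close> play no role here.\<close>

locale vector_space_over = field K + Module.module K L
  for K :: "('k, 'p) ring_scheme" (structure) and L :: "('k, 'l, 'q) module_scheme" (structure)

locale bilinear_product = vector_space_over K L
  for K :: "('k, 'p) ring_scheme" (structure) and L :: "('k, 'l, 'q) module_scheme" (structure) +
  fixes prd :: "'l \<Rightarrow> 'l \<Rightarrow> 'l"
  assumes prd_closed:
      "\<lbrakk>x \<in> carrier L; y \<in> carrier L\<rbrakk> \<Longrightarrow> prd x y \<in> carrier L"
    and prd_add_left:
      "\<lbrakk>x \<in> carrier L; y \<in> carrier L; z \<in> carrier L\<rbrakk>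
        \<Longrightarrow> prd (x \<oplus>\<^bsub>L\<^esub> y) z = prd x z \<oplus>\<^bsub>L\<^esub> prd y z"
    and prd_add_right:
      "\<lbrakk>x \<in> carrier L; y \<in> carrier L; z \<in> carrier L\<rbrakk>
        \<Longrightarrow> prd x (y \<oplus>\<^bsub>L\<^esub> z) = prd x y \<oplus>\<^bsub>L\<^esub> prd x z"
    and prd_smult_left:
      "\<lbrakk>c \<in> carrier K; x \<in> carrier L; y \<in> carrier L\<rbrakk>
        \<Longrightarrow> prd (c \<odot>\<^bsub>L\<^esub> x) y = c \<odot>\<^bsub>L\<^esub> prd x y"
    and prd_smult_right:
      "\<lbrakk>c \<in> carrier K; x \<in> carrier L; y \<in> carrier L\<rbrakk>
        \<Longrightarrow> prd x (c \<odot>\<^bsub>L\<^esub> y) = c \<odot>\<^bsub>L\<^esub> prd x y"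

text \<open>Right pre-Lie algebras.\<close>

locale pre_lie_algebra = bilinear_product K L prd
  for K :: "('k, 'p) ring_scheme" (structure) and L :: "('k, 'l, 'q) module_scheme" (structure)
    and prd :: "'l \<Rightarrow> 'l \<Rightarrow> 'l" +
  assumes pre_lie:
    "\<lbrakk>x \<in> carrier L; y \<in> carrier L; z \<in> carrier L\<rbrakk>
      \<Longrightarrow> prd (prd x y) z \<ominus>\<^bsub>L\<^esub> prd x (prd y z) = prd (prd x z) y \<ominus>\<^bsub>L\<^esub> prd x (prd z y)"

locale lie_algebra = bilinear_product K L br
  for K :: "('k, 'p) ring_scheme" (structure) and L :: "('k, 'l, 'q) module_scheme" (structure)
    and br :: "'l \<Rightarrow> 'l \<Rightarrow> 'l" +
  assumes alternating: "x \<in> carrier L \<Longrightarrow> br x x = \<zero>\<^bsub>L\<^esub>"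
    and jacobi:
      "\<lbrakk>x \<in> carrier L; y \<in> carrier L; z \<in> carrier L\<rbrakk>
        \<Longrightarrow> br x (br y z) \<oplus>\<^bsub>L\<^esub> br y (br z x) \<oplus>\<^bsub>L\<^esub> br z (br x y) = \<zero>\<^bsub>L\<^esub>"

text \<open>Right post-Lie algebras.\<close>

locale post_lie_algebra = lie_algebra K L br + star: bilinear_product K L star
  for K :: "('k, 'p) ring_scheme" (structure) and L :: "('k, 'l, 'q) module_scheme" (structure)
    and br :: "'l \<Rightarrow> 'l \<Rightarrow> 'l" and star :: "'l \<Rightarrow> 'l \<Rightarrow> 'l" +
  assumes star_br:
      "\<lbrakk>x \<in> carrier L; y \<in> carrier L; z \<in> carrier L\<rbrakk>
        \<Longrightarrow> star x (br y z) =
          star (star x y) z \<ominus>\<^bsub>L\<^esub> star x (star y z) \<ominus>\<^bsub>L\<^esub> star (star x z) y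
            \<oplus>\<^bsub>L\<^esub> star x (star z y)"
    and br_star:
      "\<lbrakk>x \<in> carrier L; y \<in> carrier L; z \<in> carrier L\<rbrakk>
        \<Longrightarrow> star (br x y) z = br (star x z) y \<oplus>\<^bsub>L\<^esub> br x (star y z)"

locale lie_module = lie_algebra K L br + M: vector_space_over K M
  for K :: "('k, 'p) ring_scheme" (structure) and L :: "('k, 'l, 'q) module_scheme" (structure)
    and br :: "'l \<Rightarrow> 'l \<Rightarrow> 'l" and M :: "('k, 'v, 'r) module_scheme" (structure) +
  fixes act :: "'l \<Rightarrow> 'v \<Rightarrow> 'v"
  assumes act_closed:
      "\<lbrakk>x \<in> carrier L; v \<in> carrier M\<rbrakk> \<Longrightarrow> act x v \<in> carrier M"
    and act_add_left:
      "\<lbrakk>x \<in> carrier L; y \<in> carrier L; v \<in> carrier M\<rbrakk>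
        \<Longrightarrow> act (x \<oplus>\<^bsub>L\<^esub> y) v = act x v \<oplus>\<^bsub>M\<^esub> act y v"
    and act_add_right:
      "\<lbrakk>x \<in> carrier L; v \<in> carrier M; w \<in> carrier M\<rbrakk>
        \<Longrightarrow> act x (v \<oplus>\<^bsub>M\<^esub> w) = act x v \<oplus>\<^bsub>M\<^esub> act x w"
    and act_smult_left:
      "\<lbrakk>c \<in> carrier K; x \<in> carrier L; v \<in> carrier M\<rbrakk>
        \<Longrightarrow> act (c \<odot>\<^bsub>L\<^esub> x) v = c \<odot>\<^bsub>M\<^esub> act x v"
    and act_smult_right:
      "\<lbrakk>c \<in> carrier K; x \<in> carrier L; v \<in> carrier M\<rbrakk>
        \<Longrightarrow> act x (c \<odot>\<^bsub>M\<^esub> v) = c \<odot>\<^bsub>M\<^esub> act x v"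
    and act_br:
      "\<lbrakk>x \<in> carrier L; y \<in> carrier L; v \<in> carrier M\<rbrakk>
        \<Longrightarrow> act (br x y) v = act x (act y v) \<ominus>\<^bsub>M\<^esub> act y (act x v)"


section \<open>The base field, the space \<open>V\<close>, and direct powers\<close>

text \<open>The field \<open>'k\<close>, both as a ring and as a vector space over itself.\<close>

definition scalars :: "('k::field, 'k) module" where
  "scalars = \<lparr>carrier = UNIV, mult = (*), one = 1, zero = 0, add = (+), smult = (*)\<rparr>"

text \<open>The vector space \<open>'v\<close> with scalar multiplication \<open>scale\<close>; the entries for \<open>mult\<close> and \<open>one\<close>
  are fillers.\<close>

definition space_of :: "('k::field \<Rightarrow> 'v \<Rightarrow> 'v) \<Rightarrow> ('k, 'v::ab_group_add) module" where
  "space_of scale =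
    \<lparr>carrier = UNIV, mult = (\<lambda>_ _. 0), one = 0, zero = 0, add = (+), smult = scale\<rparr>"

text \<open>The space of \<open>N\<close>-tuples, where the index set \<open>{1,\<dots>,N}\<close> is the universe of the type \<open>'n\<close>;
  \<open>unit_tuple M i x\<close> is the tuple \<open>x \<epsilon>\<^sub>i\<close>.\<close>

definition direct_power :: "('k, 'm, 'q) module_scheme \<Rightarrow> ('k, 'n::finite \<Rightarrow> 'm) module" where
  "direct_power M =
    \<lparr>carrier = {u. \<forall>i. u i \<in> carrier M},
     mult = (\<lambda>u v i. u i \<otimes>\<^bsub>M\<^esub> v i), one = (\<lambda>i. \<one>\<^bsub>M\<^esub>),
     zero = (\<lambda>i. \<zero>\<^bsub>M\<^esub>), add = (\<lambda>u v i. u i \<oplus>\<^bsub>M\<^esub> v i),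
     smult = (\<lambda>c u i. c \<odot>\<^bsub>M\<^esub> u i)\<rparr>"

definition unit_tuple :: "('k, 'm, 'q) module_scheme \<Rightarrow> 'n \<Rightarrow> 'm \<Rightarrow> 'n \<Rightarrow> 'm" where
  "unit_tuple M i x = (\<lambda>j. if j = i then x else \<zero>\<^bsub>M\<^esub>)"

text \<open>The biadditive extension of a product given on the tuples \<open>f \<epsilon>\<^sub>i\<close> and \<open>g \<epsilon>\<^sub>j\<close>, where
  \<open>P i j f g\<close> is the value of the product of these two.\<close>

definition extend_product ::
    "('k, 'm, 'q) module_scheme \<Rightarrow> ('n::finite \<Rightarrow> 'n \<Rightarrow> 'm \<Rightarrow> 'm \<Rightarrow> ('n \<Rightarrow> 'm))
      \<Rightarrow> ('n \<Rightarrow> 'm) \<Rightarrow> ('n \<Rightarrow> 'm) \<Rightarrow> ('n \<Rightarrow> 'm)" where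
  "extend_product M P u v =
    (\<Oplus>\<^bsub>direct_power M\<^esub>i\<in>UNIV. \<Oplus>\<^bsub>direct_power M\<^esub>j\<in>UNIV. P i j (u i) (v j))"


section \<open>The space of tensors\<close>

text \<open>The type \<open>'v list \<Rightarrow>\<^sub>0 'k\<close> is the free vector space with basis all words in elements of \<open>V\<close>;
  \<open>T(V)\<close> is its quotient by the relations saying that words are multilinear in their letters.\<close>

definition free_scale :: "'k::field \<Rightarrow> ('v list \<Rightarrow>\<^sub>0 'k) \<Rightarrow> ('v list \<Rightarrow>\<^sub>0 'k)" where
  "free_scale c p = Poly_Mapping.map ((*) c) p"

definition word :: "'v list \<Rightarrow> ('v list \<Rightarrow>\<^sub>0 'k::field)" where
  "word w = Poly_Mapping.single w 1"

definition multilinear_relations ::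
    "('k::field \<Rightarrow> 'v \<Rightarrow> 'v) \<Rightarrow> ('v::ab_group_add list \<Rightarrow>\<^sub>0 'k) set" where
  "multilinear_relations scale =
    {word (s @ (x + y) # t) - word (s @ x # t) - word (s @ y # t) | s x y t. True} \<union>
    {word (s @ scale c x # t) - free_scale c (word (s @ x # t)) | s c x t. True}"

definition tensor_rel ::
    "('k::field \<Rightarrow> 'v \<Rightarrow> 'v) \<Rightarrow> (('v::ab_group_add list \<Rightarrow>\<^sub>0 'k) \<times> ('v list \<Rightarrow>\<^sub>0 'k)) set" where
  "tensor_rel scale =
    {(p, q). p - q \<in> Modules.module.span free_scale (multilinear_relations scale)}"

type_synonym ('v, 'k) tensor = "('v list \<Rightarrow>\<^sub>0 'k) set"

definition tensor_class ::
    "('k::field \<Rightarrow> 'v \<Rightarrow> 'v) \<Rightarrow> ('v::ab_group_add list \<Rightarrow>\<^sub>0 'k) \<Rightarrow> ('v, 'k) tensor" where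
  "tensor_class scale p = tensor_rel scale `` {p}"

definition linear_extension ::
    "('v list \<Rightarrow> ('v list \<Rightarrow>\<^sub>0 'k)) \<Rightarrow> ('v list \<Rightarrow>\<^sub>0 'k) \<Rightarrow> ('v list \<Rightarrow>\<^sub>0 'k::field)" where
  "linear_extension h p =
    (\<Sum>w\<in>Poly_Mapping.keys p. free_scale (Poly_Mapping.lookup p w) (h w))"

definition bilinear_extension ::
    "('v list \<Rightarrow> 'v list \<Rightarrow> ('v list \<Rightarrow>\<^sub>0 'k)) \<Rightarrow> ('v list \<Rightarrow>\<^sub>0 'k) \<Rightarrow> ('v list \<Rightarrow>\<^sub>0 'k)
      \<Rightarrow> ('v list \<Rightarrow>\<^sub>0 'k::field)" where
  "bilinear_extension h p q = linear_extension (\<lambda>s. linear_extension (h s) q) p"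

definition prepend :: "'v \<Rightarrow> ('v list \<Rightarrow>\<^sub>0 'k) \<Rightarrow> ('v list \<Rightarrow>\<^sub>0 'k::field)" where
  "prepend x = linear_extension (\<lambda>w. word (x # w))"

fun shuffle_words :: "'v list \<Rightarrow> 'v list \<Rightarrow> ('v list \<Rightarrow>\<^sub>0 'k::field)" where
  "shuffle_words [] t = word t"
| "shuffle_words s [] = word s"
| "shuffle_words (x # s) (y # t) =
     prepend x (shuffle_words s (y # t)) + prepend y (shuffle_words (x # s) t)"

text \<open>The recursion \<open>(x f)\<epsilon>\<^sub>i * g\<epsilon>\<^sub>j = x (f\<epsilon>\<^sub>i * g\<epsilon>\<^sub>j) + F\<^sub>j(x) (f sh g)\<epsilon>\<^sub>i\<close> only involves the coordinate
  \<open>i\<close>; the function below computes this coordinate, for \<open>\<phi> = F\<^sub>j\<close>.\<close>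

fun star_words :: "('v \<Rightarrow> 'v) \<Rightarrow> 'v list \<Rightarrow> 'v list \<Rightarrow> ('v list \<Rightarrow>\<^sub>0 'k::field)" where
  "star_words \<phi> [] t = 0"
| "star_words \<phi> (x # s) t =
     prepend x (star_words \<phi> s t) + prepend (\<phi> x) (shuffle_words s t)"

text \<open>\<open>T(V)\<close> as a vector space; its ring multiplication is the shuffle product.\<close>

definition tensors :: "('k::field \<Rightarrow> 'v \<Rightarrow> 'v) \<Rightarrow> ('k, ('v::ab_group_add, 'k) tensor) module" where
  "tensors scale =
    \<lparr>carrier = UNIV // tensor_rel scale,
     mult = (\<lambda>A B. \<Union>p\<in>A. \<Union>q\<in>B. tensor_class scale (bilinear_extension shuffle_words p q)),
     one = tensor_class scale (word []),
     zero = tensor_class scale 0,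
     add = (\<lambda>A B. \<Union>p\<in>A. \<Union>q\<in>B. tensor_class scale (p + q)),
     smult = (\<lambda>c A. \<Union>p\<in>A. tensor_class scale (free_scale c p))\<rparr>"

definition star_tensor ::
    "('k::field \<Rightarrow> 'v \<Rightarrow> 'v) \<Rightarrow> ('v \<Rightarrow> 'v) \<Rightarrow> ('v::ab_group_add, 'k) tensor \<Rightarrow> ('v, 'k) tensor
      \<Rightarrow> ('v, 'k) tensor" where
  "star_tensor scale \<phi> A B =
    (\<Union>p\<in>A. \<Union>q\<in>B. tensor_class scale (bilinear_extension (star_words \<phi>) p q))"


section \<open>The products on \<open>T(V)\<^sup>N\<close>\<close>

abbreviation tensor_tuples ::
    "('k::field \<Rightarrow> 'v \<Rightarrow> 'v) \<Rightarrow> ('k, 'n::finite \<Rightarrow> ('v::ab_group_add, 'k) tensor) module" where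
  "tensor_tuples scale \<equiv> direct_power (tensors scale)"

definition star_product ::
    "('k::field \<Rightarrow> 'v \<Rightarrow> 'v) \<Rightarrow> ('n::finite \<Rightarrow> 'v \<Rightarrow> 'v)
      \<Rightarrow> ('n \<Rightarrow> ('v::ab_group_add, 'k) tensor) \<Rightarrow> ('n \<Rightarrow> ('v, 'k) tensor)
      \<Rightarrow> ('n \<Rightarrow> ('v, 'k) tensor)" where
  "star_product scale F =
    extend_product (tensors scale)
      (\<lambda>i j f g. unit_tuple (tensors scale) i (star_tensor scale (F j) f g))"

definition a_shuffle ::
    "('k::field \<Rightarrow> 'v \<Rightarrow> 'v) \<Rightarrow> ('n::finite \<Rightarrow> 'k)
      \<Rightarrow> ('n \<Rightarrow> ('v::ab_group_add, 'k) tensor) \<Rightarrow> ('n \<Rightarrow> ('v, 'k) tensor)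
      \<Rightarrow> ('n \<Rightarrow> ('v, 'k) tensor)" where
  "a_shuffle scale a =
    extend_product (tensors scale)
      (\<lambda>i j f g. a i \<odot>\<^bsub>tensor_tuples scale\<^esub>
        unit_tuple (tensors scale) j (f \<otimes>\<^bsub>tensors scale\<^esub> g))"

definition a_bracket ::
    "('k::field \<Rightarrow> 'v \<Rightarrow> 'v) \<Rightarrow> ('n::finite \<Rightarrow> 'k)
      \<Rightarrow> ('n \<Rightarrow> ('v::ab_group_add, 'k) tensor) \<Rightarrow> ('n \<Rightarrow> ('v, 'k) tensor)
      \<Rightarrow> ('n \<Rightarrow> ('v, 'k) tensor)" where
  "a_bracket scale a =
    extend_product (tensors scale)
      (\<lambda>i j f g.
        a i \<odot>\<^bsub>tensor_tuples scale\<^esub> unit_tuple (tensors scale) j (f \<otimes>\<^bsub>tensors scale\<^esub> g)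
        \<ominus>\<^bsub>tensor_tuples scale\<^esub>
        a j \<odot>\<^bsub>tensor_tuples scale\<^esub> unit_tuple (tensors scale) i (f \<otimes>\<^bsub>tensors scale\<^esub> g))"

definition bullet_product ::
    "('k::field \<Rightarrow> 'v \<Rightarrow> 'v) \<Rightarrow> ('n::finite \<Rightarrow> 'v \<Rightarrow> 'v) \<Rightarrow> ('n \<Rightarrow> 'k)
      \<Rightarrow> ('n \<Rightarrow> ('v::ab_group_add, 'k) tensor) \<Rightarrow> ('n \<Rightarrow> ('v, 'k) tensor)
      \<Rightarrow> ('n \<Rightarrow> ('v, 'k) tensor)" where
  "bullet_product scale F a u v =
    star_product scale F u v \<oplus>\<^bsub>tensor_tuples scale\<^esub> a_shuffle scale a u v"


section \<open>The Lie algebra \<open>\<gg>\<^sub>a\<close> and its action on \<open>V\<close>\<close>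

text \<open>The bracket on \<open>K\<^sup>N\<close> with \<open>[\<epsilon>\<^sub>i, \<epsilon>\<^sub>j]\<^sub>a = a\<^sub>j \<epsilon>\<^sub>i - a\<^sub>i \<epsilon>\<^sub>j\<close>.\<close>

definition ga_bracket ::
    "('n::finite \<Rightarrow> 'k::field) \<Rightarrow> ('n \<Rightarrow> 'k) \<Rightarrow> ('n \<Rightarrow> 'k) \<Rightarrow> ('n \<Rightarrow> 'k)" where
  "ga_bracket a =
    extend_product scalars
      (\<lambda>i j c d. (c * d) \<odot>\<^bsub>direct_power scalars\<^esub>
        (a j \<odot>\<^bsub>direct_power scalars\<^esub> unit_tuple scalars i 1
         \<ominus>\<^bsub>direct_power scalars\<^esub>
         a i \<odot>\<^bsub>direct_power scalars\<^esub> unit_tuple scalars j 1))"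

text \<open>The linear extension of \<open>\<epsilon>\<^sub>i . v = F\<^sub>i(v)\<close>.\<close>

definition action ::
    "('k::field \<Rightarrow> 'v \<Rightarrow> 'v) \<Rightarrow> ('n::finite \<Rightarrow> 'v \<Rightarrow> 'v) \<Rightarrow> ('n \<Rightarrow> 'k) \<Rightarrow> 'v \<Rightarrow> 'v::ab_group_add" where
  "action scale F c v = (\<Sum>i\<in>UNIV. scale (c i) (F i v))"

end

theory Submission
  imports Defs "HOL-Library.Function_Algebras"
begin

text \<open>
  Both \<open>sh\<close> and \<open>*\<close> lift to the free vector space on words, where the following hold exactly,
  before any multilinearity is imposed: \<open>sh\<close> is commutative and associative, each
  \<open>f \<mapsto> f *\<^sub>\<phi> g\<close> is a derivation of \<open>sh\<close>, and the antisymmetrisation in \<open>(\<phi>, g)\<close>, \<open>(\<psi>, h)\<close> of the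
  associator \<open>(f *\<^sub>\<phi> g) *\<^sub>\<psi> h - f *\<^sub>\<phi> (g *\<^sub>\<psi> h)\<close> is
  \<open>f *\<^bsub>\<psi>\<phi>\<^esub> (g sh h) - f *\<^bsub>\<phi>\<psi>\<^esub> (g sh h)\<close>. As \<open>\<^sub>a sh\<close> is associative and
  \<open>*\<close> acts on it by derivations, the defect of the pre-Lie identity for \<open>\<bullet>\<close> equals the defect of the
  first post-Lie identity, the other post-Lie axioms being automatic. On \<open>f\<epsilon>\<^sub>k\<close>, \<open>g\<epsilon>\<^sub>i\<close>, \<open>h\<epsilon>\<^sub>j\<close> this
  common defect is \<open>f *\<^sub>\<theta> (g sh h)\<close> with \<open>\<theta> = F\<^sub>jF\<^sub>i - F\<^sub>iF\<^sub>j - a\<^sub>iF\<^sub>j + a\<^sub>jF\<^sub>i\<close>. It vanishes if \<open>\<theta> = 0\<close>, and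
  for a letter \<open>f = x\<close> and \<open>g = h = \<emptyset>\<close> it is the letter \<open>\<theta>(x)\<close>, so the converse follows from the
  injectivity of \<open>V \<rightarrow> T(V)\<close>.
\<close>

section \<open>Words and shuffles\<close>

lemma lookup_free_scale [simp]:
  "Poly_Mapping.lookup (free_scale c p) w = c * Poly_Mapping.lookup p w"
  unfolding free_scale_def by (simp add: map.rep_eq when_def)

text \<open>A copy of \<^locale>\<open>vector_space\<close>: definitions made in that locale itself would be carried over to
  the library's interpretation \<open>real_vector\<close> and shadow the local names.\<close>

locale linear_space = vector_space scale
  for scale :: "'k::field \<Rightarrow> 'v::ab_group_add \<Rightarrow> 'v"
begin

text \<open>The values lie in an arbitrary space, because besides the free space also
  \<open>V\<close> occurs as a target, for \<open>letter_part\<close>.\<close>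

definition extension :: "('c list \<Rightarrow> 'v) \<Rightarrow> ('c list \<Rightarrow>\<^sub>0 'k) \<Rightarrow> 'v" where
  "extension h p = (\<Sum>w\<in>Poly_Mapping.keys p. scale (Poly_Mapping.lookup p w) (h w))"

lemma extension_superset:
  fixes p :: "'c list \<Rightarrow>\<^sub>0 'k"
  assumes "finite A" "Poly_Mapping.keys p \<subseteq> A"
  shows "extension h p = (\<Sum>w\<in>A. scale (Poly_Mapping.lookup p w) (h w))"
  unfolding extension_def
  by (rule sum.mono_neutral_left) (use assms in \<open>auto simp: in_keys_iff\<close>)

lemma extension_add: "extension h (p + q) = extension h p + extension h q"
proof -
  define A where "A = Poly_Mapping.keys p \<union> Poly_Mapping.keys q"
  have A: "finite A" "Poly_Mapping.keys p \<subseteq> A" "Poly_Mapping.keys q \<subseteq> A"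
    "Poly_Mapping.keys (p + q) \<subseteq> A"
    using keys_add[of p q] by (auto simp: A_def)
  show ?thesis
    by (simp add: extension_superset[OF A(1)] A lookup_add scale_left_distrib sum.distrib)
qed

lemma extension_scale: "extension h (free_scale c p) = scale c (extension h p)"
proof -
  have "Poly_Mapping.keys (free_scale c p) \<subseteq> Poly_Mapping.keys p"
    by (auto simp: in_keys_iff)
  then show ?thesis
    by (simp add: extension_superset[OF finite_keys[of p]] scale_sum_right)
qed

lemma extension_word: "extension h (word w) = h w"
  unfolding extension_def word_def by simp

end

section \<open>Linear and bilinear maps on the free vector space\<close>

global_interpretation free: linear_space "free_scale :: 'k::field \<Rightarrow> ('v list \<Rightarrow>\<^sub>0 'k) \<Rightarrow> _"
  by unfold_locales (auto intro!: poly_mapping_eqI simp: lookup_add algebra_simps)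

lemma free_sum_words:
  "p = (\<Sum>w\<in>Poly_Mapping.keys p. free_scale (Poly_Mapping.lookup p w) (word w))"
  by (intro poly_mapping_eqI)
    (simp add: lookup_sum word_def lookup_single when_def if_distrib in_keys_iff cong: if_cong)

text \<open>Words span the free space; zero is covered as \<open>0\<close> times a word. Identities
  linear in each argument thereby reduce to words.\<close>

lemma free_induct [case_names word add scale]:
  assumes word: "\<And>w. P (word w)"
    and add: "\<And>p q. P p \<Longrightarrow> P q \<Longrightarrow> P (p + q)"
    and scale: "\<And>c p. P p \<Longrightarrow> P (free_scale c p)"
  shows "P p"
proof -
  have zero: "P 0" using scale[of "word []" 0] word by simp
  have "P (\<Sum>w\<in>A. free_scale (Poly_Mapping.lookup p w) (word w))" if "finite A" for A
    using that by induction (auto intro: zero word add scale)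
  then show ?thesis by (metis free_sum_words finite_keys)
qed

lemma linear_extension_eq: "linear_extension h p = free.extension h p"
  by (simp add: linear_extension_def free.extension_def)

lemma linear_extension_add:
  "linear_extension h (p + q) = linear_extension h p + linear_extension h q"
  by (simp add: linear_extension_eq free.extension_add)

lemma linear_extension_scale:
  "linear_extension h (free_scale c p) = free_scale c (linear_extension h p)"
  by (simp add: linear_extension_eq free.extension_scale)

lemma linear_extension_word [simp]: "linear_extension h (word w) = h w"
  by (simp add: linear_extension_eq free.extension_word)

lemma linear_extension_add_fun:
  "linear_extension (\<lambda>w. h w + k w) p = linear_extension h p + linear_extension k p"
  by (induction p rule: free_induct)
    (simp_all add: linear_extension_add linear_extension_scale algebra_simps)

lemma linear_extension_scale_fun:
  "linear_extension (\<lambda>w. free_scale c (h w)) p = free_scale c (linear_extension h p)"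
  by (induction p rule: free_induct)
    (simp_all add: linear_extension_add linear_extension_scale algebra_simps)

lemma bilinear_extension_linear:
  "bilinear_extension h (p + p') q = bilinear_extension h p q + bilinear_extension h p' q"
  "bilinear_extension h p (q + q') = bilinear_extension h p q + bilinear_extension h p q'"
  "bilinear_extension h (free_scale c p) q = free_scale c (bilinear_extension h p q)"
  "bilinear_extension h p (free_scale c q) = free_scale c (bilinear_extension h p q)"
  by (simp_all add: bilinear_extension_def linear_extension_add linear_extension_scale
      linear_extension_add_fun linear_extension_scale_fun)

lemma bilinear_extension_word: "bilinear_extension h (word s) (word t) = h s t"
  by (simp add: bilinear_extension_def)

lemma prepend_linear:
  "prepend x (p + q) = prepend x p + prepend x q"
  "prepend x (free_scale c p) = free_scale c (prepend x p)"
  by (simp_all add: prepend_def linear_extension_add linear_extension_scale)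

lemma word_Cons: "word (x # w) = prepend x (word w)"
  by (simp add: prepend_def)

lemma additive_prepend: "additive (prepend x)"
  by unfold_locales (rule prepend_linear)

lemma additive_bilinear_extension_left: "additive (\<lambda>p. bilinear_extension h p q)"
  by unfold_locales (rule bilinear_extension_linear)

lemma additive_bilinear_extension_right: "additive (bilinear_extension h p)"
  by unfold_locales (rule bilinear_extension_linear)

lemmas free_linear =
  bilinear_extension_linear prepend_linear
  additive.zero[OF additive_prepend] additive.diff[OF additive_prepend]
  additive.zero[OF additive_bilinear_extension_left]
  additive.diff[OF additive_bilinear_extension_left]
  additive.sum[OF additive_bilinear_extension_left]
  additive.zero[OF additive_bilinear_extension_right]
  additive.diff[OF additive_bilinear_extension_right]
  additive.sum[OF additive_bilinear_extension_right]

section \<open>Shuffle and star products of free elements\<close>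

abbreviation shuffle (infixl \<open>\<diamondop>\<close> 70) where
  "p \<diamondop> q \<equiv> bilinear_extension shuffle_words p q"

abbreviation star where
  "star \<phi> \<equiv> bilinear_extension (star_words \<phi>)"

lemma shuffle_words_Nil_right: "shuffle_words s [] = word s"
  by (cases s) simp_all

lemma shuffle_empty [simp]: "word [] \<diamondop> p = p" "p \<diamondop> word [] = p"
  by (induction p rule: free_induct) (simp_all add: free_linear shuffle_words_Nil_right bilinear_extension_word)

text \<open>The recursion for words extends bilinearly, and then applies also to tails that are
  themselves products.\<close>

lemma shuffle_prepend:
  "prepend x p \<diamondop> prepend y q = prepend x (p \<diamondop> prepend y q) + prepend y (prepend x p \<diamondop> q)"
proof (induction p rule: free_induct)
  case (word s)
  show ?case by (induction q rule: free_induct)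
        (simp_all add: free_linear bilinear_extension_word algebra_simps flip: word_Cons)
qed (simp_all add: free_linear algebra_simps)

lemma star_empty [simp]: "star \<phi> (word []) q = 0"
  by (induction q rule: free_induct) (simp_all add: free_linear bilinear_extension_word)

lemma star_prepend: "star \<phi> (prepend x p) q = prepend x (star \<phi> p q) + prepend (\<phi> x) (p \<diamondop> q)"
proof (induction p rule: free_induct)
  case (word s)
  show ?case by (induction q rule: free_induct)
        (simp_all add: free_linear bilinear_extension_word algebra_simps flip: word_Cons)
qed (simp_all add: free_linear algebra_simps)

lemma shuffle_commute:
  fixes p q :: "'v list \<Rightarrow>\<^sub>0 'k::field"
  shows "p \<diamondop> q = q \<diamondop> p"
proof -
  let ?word = "word :: 'v list \<Rightarrow> 'v list \<Rightarrow>\<^sub>0 'k"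
  have words: "?word s \<diamondop> ?word t = ?word t \<diamondop> ?word s" for s t
    by (induction s t rule: shuffle_words.induct)
      (simp_all add: word_Cons shuffle_prepend)
  have left: "?word s \<diamondop> q = q \<diamondop> ?word s" for s
    by (induction q rule: free_induct) (simp_all only: words free_linear)
  show ?thesis
    by (induction p rule: free_induct) (simp_all only: left free_linear)
qed

text \<open>In either bracketing the leading letter comes from one of the three factors, and the
  three kinds of terms correspond.\<close>

lemma shuffle_assoc:
  fixes p q r :: "'v list \<Rightarrow>\<^sub>0 'k::field"
  shows "(p \<diamondop> q) \<diamondop> r = p \<diamondop> (q \<diamondop> r)"
proof -
  let ?word = "word :: 'v list \<Rightarrow> 'v list \<Rightarrow>\<^sub>0 'k"
  have left: "(prepend x p \<diamondop> prepend y q) \<diamondop> prepend z r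
      = prepend x ((p \<diamondop> prepend y q) \<diamondop> prepend z r)
      + prepend y ((prepend x p \<diamondop> q) \<diamondop> prepend z r)
      + prepend z ((prepend x p \<diamondop> prepend y q) \<diamondop> r)"
    and right: "prepend x p \<diamondop> (prepend y q \<diamondop> prepend z r)
      = prepend x (p \<diamondop> (prepend y q \<diamondop> prepend z r))
      + prepend y (prepend x p \<diamondop> (q \<diamondop> prepend z r))
      + prepend z (prepend x p \<diamondop> (prepend y q \<diamondop> r))"
    for x y z and p q r :: "'v list \<Rightarrow>\<^sub>0 'k"
    by (simp_all add: shuffle_prepend free_linear algebra_simps)
  have words: "(?word s \<diamondop> ?word t) \<diamondop> ?word u = ?word s \<diamondop> (?word t \<diamondop> ?word u)" for s t u
  \<comment> \<open>Each of the three terms shortens a different word, so the measure is the total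
    length.\<close>
  proof (induction "length s + length t + length u" arbitrary: s t u rule: less_induct)
    case less
    show ?case
    proof (cases "s = [] \<or> t = [] \<or> u = []")
      case False
      then obtain x s' y t' z u' where [simp]: "s = x # s'" "t = y # t'" "u = z # u'"
        by (metis list.exhaust)
      have 1: "(?word s' \<diamondop> prepend y (?word t')) \<diamondop> prepend z (?word u')
          = ?word s' \<diamondop> (prepend y (?word t') \<diamondop> prepend z (?word u'))"
        using less[of s' t u] by (simp add: word_Cons)
      have 2: "(prepend x (?word s') \<diamondop> ?word t') \<diamondop> prepend z (?word u')
          = prepend x (?word s') \<diamondop> (?word t' \<diamondop> prepend z (?word u'))"
        using less[of s t' u] by (simp add: word_Cons)
      have 3: "(prepend x (?word s') \<diamondop> prepend y (?word t')) \<diamondop> ?word u'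
          = prepend x (?word s') \<diamondop> (prepend y (?word t') \<diamondop> ?word u')"
        using less[of s t u'] by (simp add: word_Cons)
      show ?thesis using 1 2 3
        by (simp only: \<open>s = x # s'\<close> \<open>t = y # t'\<close> \<open>u = z # u'\<close> word_Cons left right)
    qed auto
  qed
  have 1: "(?word s \<diamondop> ?word t) \<diamondop> r = ?word s \<diamondop> (?word t \<diamondop> r)" for s t
    by (induction r rule: free_induct) (simp_all only: words free_linear)
  have 2: "(?word s \<diamondop> q) \<diamondop> r = ?word s \<diamondop> (q \<diamondop> r)" for s
    by (induction q rule: free_induct) (simp_all only: 1 free_linear)
  show ?thesis
    by (induction p rule: free_induct) (simp_all only: 2 free_linear)
qed

text \<open>The star of a word is a sum over its letters: the chosen letter is replaced by its image
  under \<open>\<phi>\<close>, and the letters after it are shuffled with \<open>r\<close>. Choosing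
  a letter of a shuffle means choosing one of \<open>p\<close> or one of \<open>q\<close>.\<close>

lemma star_shuffle: "star \<phi> (p \<diamondop> q) r = star \<phi> p r \<diamondop> q + p \<diamondop> star \<phi> q r"
proof -
  have words: "star \<phi> (word s \<diamondop> word t) r = star \<phi> (word s) r \<diamondop> word t + word s \<diamondop> star \<phi> (word t) r"
    for s t
  proof (induction s t rule: shuffle_words.induct)
    case (3 x s y t)
    \<comment> \<open>This and \<open>comm'\<close> regroup the factors so that \<open>r\<close>
      stands last, as in the expansion of the left-hand side.\<close>
    have comm: "prepend x (word s) \<diamondop> prepend (\<phi> y) (word t \<diamondop> r) =
      prepend x (word s \<diamondop> prepend (\<phi> y) (word t \<diamondop> r))
      + prepend (\<phi> y) ((prepend x (word s) \<diamondop> word t) \<diamondop> r)"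
      by (simp add: shuffle_prepend shuffle_assoc)
    have comm': "prepend (\<phi> x) (word s \<diamondop> r) \<diamondop> prepend y (word t) =
      prepend (\<phi> x) ((word s \<diamondop> prepend y (word t)) \<diamondop> r)
      + prepend y (prepend (\<phi> x) (word s \<diamondop> r) \<diamondop> word t)"
      by (simp add: shuffle_prepend shuffle_assoc shuffle_commute[of r])
    show ?case using 3
      by (simp add: word_Cons shuffle_prepend[of x "word s" y "word t"]
         shuffle_prepend[of x "star \<phi> p q" for p q] shuffle_prepend[of x _ y "star \<phi> p q" for p q]
         star_prepend comm comm' free_linear algebra_simps)
  qed (simp_all add: free_linear)
  have left: "star \<phi> (word s \<diamondop> q) r = star \<phi> (word s) r \<diamondop> q + word s \<diamondop> star \<phi> q r" for s
    by (induction q rule: free_induct) (simp_all add: words free_linear algebra_simps)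
  show ?thesis
    by (induction p rule: free_induct) (simp_all add: left free_linear algebra_simps)
qed

text \<open>After splitting off a first letter \<open>x\<close>, the terms headed by
  \<open>\<phi> x\<close> or \<open>\<psi> x\<close> cancel by \<open>star_shuffle\<close>. The
  terms headed by \<open>\<psi> (\<phi> x)\<close> and \<open>\<phi> (\<psi> x)\<close>
  survive.\<close>

lemma star_star_commutator:
  "star \<psi> (star \<phi> p q) r - star \<phi> p (star \<psi> q r) - star \<phi> (star \<psi> p r) q + star \<psi> p (star \<phi> r q)
    = star (\<lambda>x. \<psi> (\<phi> x)) p (q \<diamondop> r) - star (\<lambda>x. \<phi> (\<psi> x)) p (q \<diamondop> r)"
proof -
  have words: "star \<psi> (star \<phi> (word s) q) r - star \<phi> (word s) (star \<psi> q r)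
      - star \<phi> (star \<psi> (word s) r) q + star \<psi> (word s) (star \<phi> r q)
    = star (\<lambda>x. \<psi> (\<phi> x)) (word s) (q \<diamondop> r) - star (\<lambda>x. \<phi> (\<psi> x)) (word s) (q \<diamondop> r)" (is "?D s = ?E s")
    for s
  proof (induction s)
    case (Cons x s)
    have "?D (x # s) = prepend x (?D s) + prepend (\<psi> (\<phi> x)) (word s \<diamondop> (q \<diamondop> r))
      - prepend (\<phi> (\<psi> x)) (word s \<diamondop> (q \<diamondop> r))"
      by (simp add: word_Cons star_prepend star_shuffle shuffle_assoc free_linear
          shuffle_commute[of r q] shuffle_commute[of "star \<psi> q r" "word s"] algebra_simps)
    also have "\<dots> = ?E (x # s)"
      unfolding Cons by (simp add: word_Cons star_prepend free_linear algebra_simps)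
    finally show ?case .
  qed (simp add: free_linear)
  show ?thesis (is "?D p = ?E p")
  proof (induction p rule: free_induct)
    case (add p p')
    have "?D (p + p') = ?D p + ?D p'" "?E (p + p') = ?E p + ?E p'"
      by (simp_all add: free_linear algebra_simps)
    then show ?case using add by (simp only:)
  next
    case (scale c p)
    have "?D (free_scale c p) = free_scale c (?D p)" "?E (free_scale c p) = free_scale c (?E p)"
      by (simp_all add: free_linear algebra_simps)
    then show ?case using scale by (simp only:)
  qed (rule words)
qed

section \<open>The multilinear relations\<close>

context linear_space
begin

abbreviation relators :: "('v list \<Rightarrow>\<^sub>0 'k) set" where
  "relators \<equiv> free.span (multilinear_relations scale)"

text \<open>Both kinds of defining relations are instances (\<open>c = d = 1\<close>, or
  \<open>d = 0\<close>), so stability proofs treat a single family.\<close>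

definition relator :: "'v list \<Rightarrow> 'k \<Rightarrow> 'v \<Rightarrow> 'k \<Rightarrow> 'v \<Rightarrow> 'v list \<Rightarrow> ('v list \<Rightarrow>\<^sub>0 'k)" where
  "relator s c x d y t = word (s @ (scale c x + scale d y) # t)
    - free_scale c (word (s @ x # t)) - free_scale d (word (s @ y # t))"

lemma relator_in_relators: "relator s c x d y t \<in> relators"
proof -
  have smult: "word (s @ scale c x # t) - free_scale c (word (s @ x # t)) \<in> relators" for c x
    by (rule free.span_base) (unfold multilinear_relations_def, blast)
  have add: "word (s @ (x + y) # t) - word (s @ x # t) - word (s @ y # t) \<in> relators" for x y
    by (rule free.span_base) (unfold multilinear_relations_def, blast)
  show ?thesis
    using free.span_add[OF free.span_add[OF add[of "scale c x" "scale d y"] smult[of c x]] smult[of d y]]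
    by (simp add: relator_def algebra_simps)
qed

lemma relators_induct [consumes 1, case_names relator add scale]:
  assumes r: "r \<in> relators"
    and relator: "\<And>s c x d y t. P (relator s c x d y t)"
    and add: "\<And>p q. P p \<Longrightarrow> P q \<Longrightarrow> P (p + q)"
    and scale: "\<And>c p. P p \<Longrightarrow> P (free_scale c p)"
  shows "P r"
  using r
proof (induction rule: free.span_induct_alt)
  case base
  \<comment> \<open>Zero arises as \<open>0\<close> times an arbitrary relator.\<close>
  show ?case using scale[of "relator [] 0 0 0 0 []" 0] relator by simp
next
  case (step c r q)
  have "P r" using step(1) unfolding multilinear_relations_def
  proof (elim UnE CollectE exE conjE)
    fix s x y t
    assume "r = word (s @ (x + y) # t) - word (s @ x # t) - word (s @ y # t)"
    with relator[of s 1 x 1 y t] show "P r" by (simp add: relator_def)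
  next
    fix s c x t
    assume "r = word (s @ scale c x # t) - free_scale c (word (s @ x # t))"
    with relator[of s c x 0 0 t] show "P r" by (simp add: relator_def)
  qed
  then show ?case using step(2) by (intro add scale)
qed

text \<open>Modulo relators, prepending is linear in the letter: for a word \<open>p\<close> this is
  a relator with empty prefix.\<close>

lemma prepend_combination:
  "prepend (scale c x + scale d y) p - free_scale c (prepend x p) - free_scale d (prepend y p)
    \<in> relators" (is "?f p \<in> _")
proof (induction p rule: free_induct)
  case (word w)
  show ?case using relator_in_relators[of "[]" c x d y w] by (simp add: relator_def word_Cons)
next
  case (add p q)
  have "?f (p + q) = ?f p + ?f q" by (simp add: free_linear algebra_simps)
  then show ?case using add by (simp only: free.span_add)
next
  case (scale b p)
  have "?f (free_scale b p) = free_scale b (?f p)"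
    by (simp add: free_linear algebra_simps)
  then show ?case using scale by (simp only: free.span_scale)
qed

lemma prepend_relator: "prepend z (relator s c x d y t) = relator (z # s) c x d y t"
  by (simp add: relator_def free_linear word_Cons)

lemma prepend_relators: "r \<in> relators \<Longrightarrow> prepend z r \<in> relators"
  by (induction rule: relators_induct)
    (simp_all add: free_linear prepend_relator relator_in_relators free.span_add free.span_scale)

lemma relator_Nil: "relator [] c x d y t =
  prepend (scale c x + scale d y) (word t) - free_scale c (prepend x (word t))
    - free_scale d (prepend y (word t))"
  by (simp add: relator_def word_Cons)

text \<open>A leading letter taken from \<open>u\<close>, or from a nonempty prefix
  \<open>s\<close>, leaves a smaller case. If \<open>s\<close> is empty, the multilinear letter
  itself may lead, and \<open>prepend_combination\<close> applies.\<close>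

lemma shuffle_relators_left:
  assumes "r \<in> relators" shows "r \<diamondop> q \<in> relators"
proof -
  have words: "relator s c x d y t \<diamondop> word u \<in> relators" for s c x d y t u
  proof (induction "length s + length u" arbitrary: s u rule: less_induct)
    case less
    show ?case
    proof (cases u)
      case Nil
      then show ?thesis by (simp add: relator_in_relators)
    next
      case u: (Cons z u')
      show ?thesis
      proof (cases s)
        case Nil
        have "relator [] c x d y t \<diamondop> word u =
          (prepend (scale c x + scale d y) (word t \<diamondop> word u)
            - free_scale c (prepend x (word t \<diamondop> word u))
            - free_scale d (prepend y (word t \<diamondop> word u)))
          + prepend z (relator [] c x d y t \<diamondop> word u')"
          by (simp add: u relator_Nil word_Cons shuffle_prepend free_linear algebra_simps)
        moreover have "relator [] c x d y t \<diamondop> word u' \<in> relators"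
          using less[of "[]" u'] by (simp add: u Nil)
        ultimately show ?thesis
          unfolding Nil using prepend_combination prepend_relators free.span_add by metis
      next
        case (Cons z' s')
        have "relator s c x d y t \<diamondop> word u =
          prepend z' (relator s' c x d y t \<diamondop> word u) + prepend z (relator s c x d y t \<diamondop> word u')"
          by (simp add: u Cons word_Cons shuffle_prepend flip: prepend_relator)
        moreover have "relator s' c x d y t \<diamondop> word u \<in> relators" "relator s c x d y t \<diamondop> word u' \<in> relators"
          using less[of s' u] less[of s u'] by (simp_all add: u Cons)
        ultimately show ?thesis
          using prepend_relators free.span_add by metis
      qed
    qed
  qed
  have "relator s c x d y t \<diamondop> q \<in> relators" for s c x d y t
    by (induction q rule: free_induct) (simp_all add: words free_linear free.span_add free.span_scale)
  with assms show ?thesis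
    by (induction rule: relators_induct) (simp_all add: free_linear free.span_add free.span_scale)
qed

lemma shuffle_relators_right: "r \<in> relators \<Longrightarrow> q \<diamondop> r \<in> relators"
  by (subst shuffle_commute) (rule shuffle_relators_left)

text \<open>Linearity of \<open>\<phi>\<close> enters when the multilinear letter is the one acted
  on: its image is again a linear combination of two letters.\<close>

lemma star_relators_left:
  assumes "r \<in> relators" and "Vector_Spaces.linear scale scale \<phi>"
  shows "star \<phi> r q \<in> relators"
proof -
  interpret \<phi>: Vector_Spaces.linear scale scale \<phi> by fact
  have "star \<phi> (relator s c x d y t) q \<in> relators" for s c x d y t
  proof (induction s)
    case Nil
    have "star \<phi> (relator [] c x d y t) q =
      (prepend (scale c x + scale d y) (star \<phi> (word t) q)
        - free_scale c (prepend x (star \<phi> (word t) q))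
        - free_scale d (prepend y (star \<phi> (word t) q)))
      + (prepend (scale c (\<phi> x) + scale d (\<phi> y)) (word t \<diamondop> q)
        - free_scale c (prepend (\<phi> x) (word t \<diamondop> q))
        - free_scale d (prepend (\<phi> y) (word t \<diamondop> q)))"
      by (simp add: relator_Nil star_prepend free_linear \<phi>.add \<phi>.scale algebra_simps)
    then show ?case by (simp only: prepend_combination free.span_add)
  next
    case (Cons z s)
    have "star \<phi> (relator (z # s) c x d y t) q =
      prepend z (star \<phi> (relator s c x d y t) q) + prepend (\<phi> z) (relator s c x d y t \<diamondop> q)"
      by (simp add: star_prepend flip: prepend_relator)
    then show ?case
      using free.span_add[OF prepend_relators[OF Cons]
          prepend_relators[OF shuffle_relators_left[OF relator_in_relators]]]
      by (simp only:)
  qed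
  with assms(1) show ?thesis
    by (induction rule: relators_induct) (simp_all add: free_linear free.span_add free.span_scale)
qed

text \<open>The second argument is only ever shuffled into tails of the first, so stability of the
  shuffle suffices.\<close>

lemma star_relators_right:
  assumes "r \<in> relators" shows "star \<phi> q r \<in> relators"
proof (induction q rule: free_induct)
  case (word w)
  show ?case
  proof (induction w)
    case (Cons x w)
    then show ?case
      by (simp add: word_Cons star_prepend prepend_relators shuffle_relators_right assms
          free.span_add)
  qed (simp add: free.span_zero)
qed (simp_all add: free_linear free.span_add free.span_scale)

text \<open>Every term of the star contains exactly one letter produced by the endomorphism, so
  modulo relators the star is linear in the endomorphism.\<close>

lemma star_combination:
  "star (\<lambda>x. scale c (\<phi> x) + scale d (\<psi> x)) p q
    - free_scale c (star \<phi> p q) - free_scale d (star \<psi> p q) \<in> relators" (is "?f p \<in> _")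
proof (induction p rule: free_induct)
  case (word w)
  show ?case
  proof (induction w)
    case (Cons x w)
    have "?f (word (x # w)) = prepend x (?f (word w)) +
      (prepend (scale c (\<phi> x) + scale d (\<psi> x)) (word w \<diamondop> q)
        - free_scale c (prepend (\<phi> x) (word w \<diamondop> q))
        - free_scale d (prepend (\<psi> x) (word w \<diamondop> q)))"
      by (simp add: word_Cons star_prepend free_linear algebra_simps)
    then show ?case
      using free.span_add[OF prepend_relators[OF Cons] prepend_combination] by (simp only:)
  qed (simp add: free.span_zero)
next
  case (add p q)
  have "?f (p + q) = ?f p + ?f q" by (simp add: free_linear algebra_simps)
  then show ?case using add by (simp only: free.span_add)
next
  case (scale b p)
  have "?f (free_scale b p) = free_scale b (?f p)"
    by (simp add: free_linear algebra_simps)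
  then show ?case using scale by (simp only: free.span_scale)
qed

text \<open>The projection onto degree one. Since it kills all relators, it descends to
  \<open>T(V)\<close> and shows that \<open>V\<close> embeds there.\<close>

definition letter_part :: "('v list \<Rightarrow>\<^sub>0 'k) \<Rightarrow> 'v" where
  "letter_part = extension (\<lambda>w. case w of [x] \<Rightarrow> x | _ \<Rightarrow> 0)"

lemma letter_part_add: "letter_part (p + q) = letter_part p + letter_part q"
  and letter_part_scale: "letter_part (free_scale c p) = scale c (letter_part p)"
  and letter_part_word: "letter_part (word w) = (case w of [x] \<Rightarrow> x | _ \<Rightarrow> 0)"
  by (simp_all add: letter_part_def extension_add extension_scale extension_word)

sublocale letter_part: additive letter_part
  by unfold_locales (rule letter_part_add)

text \<open>The words in a relator have length one only if \<open>s\<close> and \<open>t\<close> are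
  empty, and then the three letters cancel.\<close>

lemma letter_part_relators:
  assumes "r \<in> relators" shows "letter_part r = 0"
  using assms
proof (induction rule: relators_induct)
  case (relator s c x d y t)
  have "letter_part (word (s @ z # t)) = (if s = [] \<and> t = [] then z else 0)" for z
    by (cases s; cases t; cases "tl s") (simp_all add: letter_part_word)
  then show ?case by (simp add: relator_def letter_part.diff letter_part_scale)
qed (simp_all add: letter_part_add letter_part_scale)

end

section \<open>Quotient presentations of vector spaces\<close>

lemma sum_fun_apply: "(\<Sum>x\<in>A. f x) k = (\<Sum>x\<in>A. f x k)"
  by (induction A rule: infinite_finite_induct) simp_all

lemma scalars_simps [simp]:
  "carrier scalars = UNIV" "\<one>\<^bsub>scalars\<^esub> = 1" "\<zero>\<^bsub>scalars\<^esub> = 0"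
  "x \<otimes>\<^bsub>scalars\<^esub> y = x * y" "x \<oplus>\<^bsub>scalars\<^esub> y = x + y" "x \<odot>\<^bsub>scalars\<^esub> y = x * y"
  by (simp_all add: scalars_def)

lemma field_scalars: "field scalars"
proof (intro cring.cring_fieldI2 cringI abelian_groupI comm_monoidI)
  fix x :: 'a
  show "\<exists>y\<in>carrier scalars. y \<oplus>\<^bsub>scalars\<^esub> x = \<zero>\<^bsub>scalars\<^esub>"
    by (rule bexI[of _ "- x"]) simp_all
next
  fix x :: 'a
  assume "x \<noteq> \<zero>\<^bsub>scalars\<^esub>"
  then show "\<exists>y\<in>carrier scalars. x \<otimes>\<^bsub>scalars\<^esub> y = \<one>\<^bsub>scalars\<^esub>"
    by (intro bexI[of _ "inverse x"]) simp_all
qed (simp_all add: algebra_simps)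

locale bilinear_map = linear_space scale
  for scale :: "'k::field \<Rightarrow> 'v::ab_group_add \<Rightarrow> 'v" +
  fixes B :: "'v \<Rightarrow> 'v \<Rightarrow> 'v"
  assumes add_left: "B (p + p') q = B p q + B p' q"
    and add_right: "B p (q + q') = B p q + B p q'"
    and scale_left: "B (scale c p) q = scale c (B p q)"
    and scale_right: "B p (scale c q) = scale c (B p q)"
begin

sublocale left: additive "\<lambda>p. B p q" for q
  by unfold_locales (rule add_left)

sublocale right: additive "B p" for p
  by unfold_locales (rule add_right)

end

text \<open>Identities in the record \<open>L\<close> become identities of representatives in a type
  class. The instances are \<open>T(V)\<close> and its tuples and, with \<open>cls\<close> the
  identity, \<open>V\<close>, \<open>K\<close> and \<open>K^N\<close>.\<close>

locale quotient_space = linear_space scale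
  for scale :: "'k::field \<Rightarrow> 'v::ab_group_add \<Rightarrow> 'v" +
  fixes L :: "('k, 'l) module" and cls :: "'v \<Rightarrow> 'l"
  assumes carrier_eq: "carrier L = range cls"
    and cls_add: "cls p \<oplus>\<^bsub>L\<^esub> cls q = cls (p + q)"
    and zero_eq: "\<zero>\<^bsub>L\<^esub> = cls 0"
    and cls_smult: "c \<odot>\<^bsub>L\<^esub> cls p = cls (scale c p)"
begin

lemma abelian_group_quotient: "abelian_group L"
proof (rule abelian_groupI)
  fix x assume "x \<in> carrier L"
  then obtain p where "x = cls p" by (auto simp: carrier_eq)
  then show "\<exists>y\<in>carrier L. y \<oplus>\<^bsub>L\<^esub> x = \<zero>\<^bsub>L\<^esub>"
    by (intro bexI[of _ "cls (- p)"]) (simp_all add: carrier_eq cls_add zero_eq)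
qed (auto simp: carrier_eq cls_add zero_eq add_ac)

lemma all_carrier_iff: "(\<forall>x. x \<in> carrier L \<longrightarrow> P x) \<longleftrightarrow> (\<forall>p. P (cls p))"
  by (auto simp: carrier_eq)

lemma cls_minus: "cls p \<ominus>\<^bsub>L\<^esub> cls q = cls (p - q)"
proof -
  interpret abelian_group L by (rule abelian_group_quotient)
  have "\<ominus>\<^bsub>L\<^esub> cls q = cls (- q)"
    by (rule minus_equality) (auto simp: carrier_eq cls_add zero_eq)
  then show ?thesis by (simp add: a_minus_def cls_add)
qed

lemma cls_sum: "(\<Oplus>\<^bsub>L\<^esub>i\<in>A. cls (f i)) = cls (\<Sum>i\<in>A. f i)" if "finite A"
proof -
  interpret abelian_group L by (rule abelian_group_quotient)
  show ?thesis using that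
    by induction (auto simp: zero_eq carrier_eq cls_add)
qed

lemma cls_eq_iff: "cls p = cls q \<longleftrightarrow> cls (p - q) = cls 0"
  by (metis cls_add cls_minus add.left_neutral diff_add_cancel diff_self)

lemma vector_space_over_quotient: "vector_space_over scalars L"
proof -
  interpret field "scalars :: ('k, 'k) module" by (rule field_scalars)
  have "Module.module (scalars :: ('k, 'k) module) L"
    by (rule moduleI)
      (auto intro: is_cring abelian_group_quotient simp: carrier_eq cls_add cls_smult algebra_simps)
  then show ?thesis
    by (intro vector_space_over.intro field_scalars)
qed

lemma bilinear_product_quotient:
  assumes "bilinear_map scale B" and prd: "\<And>p q. prd (cls p) (cls q) = cls (B p q)"
  shows "bilinear_product scalars L prd"
proof -
  interpret bilinear_map scale B by fact
  show ?thesis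
    by (intro bilinear_product.intro vector_space_over_quotient bilinear_product_axioms.intro)
      (auto simp: carrier_eq cls_add cls_smult prd add_left add_right scale_left scale_right)
qed

lemma quotient_direct_power:
  "quotient_space (\<lambda>c p i. scale c (p i)) (direct_power L) (\<lambda>p (i::'n::finite). cls (p i))"
proof
  have "u \<in> range (\<lambda>p i. cls (p i))" if "\<forall>i. u i \<in> range cls" for u :: "'n \<Rightarrow> 'l"
  proof -
    from that have "\<forall>i. \<exists>p. u i = cls p" by auto
    then obtain p where "\<forall>i. u i = cls (p i)" by metis
    then show ?thesis by auto
  qed
  then show "carrier (direct_power L) = range (\<lambda>p (i::'n). cls (p i))"
    by (auto simp: direct_power_def carrier_eq)
qed (simp_all add: direct_power_def cls_add zero_eq cls_smult fun_eq_iff algebra_simps)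

lemma cls_unit_tuple: "unit_tuple L i (cls p) = (\<lambda>k. cls (if k = i then p else 0))"
  by (auto simp: unit_tuple_def zero_eq)

text \<open>\<open>Q\<close> describes a product on representatives, coordinate by coordinate; the
  record sums turn into ordinary ones.\<close>

lemma cls_extend_product:
  fixes p q :: "'n::finite \<Rightarrow> 'v"
  assumes "\<And>i j f g. P i j (cls f) (cls g) = (\<lambda>k. cls (Q i j f g k))"
  shows "extend_product L P (\<lambda>i. cls (p i)) (\<lambda>i. cls (q i))
    = (\<lambda>k. cls (\<Sum>i\<in>UNIV. \<Sum>j\<in>UNIV. Q i j (p i) (q j) k))"
proof -
  interpret power: quotient_space "\<lambda>c p i. scale c (p i)" "direct_power L" "\<lambda>p (i::'n). cls (p i)"
    by (rule quotient_direct_power)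
  show ?thesis
    by (simp add: extend_product_def assms power.cls_sum sum_fun_apply)
qed

end

text \<open>The algebraic core: \<open>S\<close> lifts the star and \<open>H\<close> lifts an
  associative product on which \<open>S\<close> acts by derivations. These laws are required of
  representatives, not just of classes.\<close>

locale derivation_pair = quotient_space scale L cls + S: bilinear_map scale S + H: bilinear_map scale H
  for scale :: "'k::field \<Rightarrow> 'v::ab_group_add \<Rightarrow> 'v" and L :: "('k, 'l) module" and cls S H +
  fixes star br bullet
  assumes H_assoc: "H (H p q) r = H p (H q r)"
    and S_H: "S (H p q) r = H (S p r) q + H p (S q r)"
    and cls_star: "star (cls p) (cls q) = cls (S p q)"
    and cls_br: "br (cls p) (cls q) = cls (H p q - H q p)"
    and cls_bullet: "bullet (cls p) (cls q) = cls (S p q + H p q)"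
begin

text \<open>Its class measures the failure of the post-Lie axiom \<open>star_br\<close>.\<close>

definition defect where
  "defect p q r = S (S p q) r - S p (S q r) - S (S p r) q + S p (S r q) - S p (H q r - H r q)"

lemma bilinear_H_commutator: "bilinear_map scale (\<lambda>p q. H p q - H q p)"
  by unfold_locales (simp_all add: H.add_left H.add_right H.scale_left H.scale_right algebra_simps)

lemma bilinear_S_plus_H: "bilinear_map scale (\<lambda>p q. S p q + H p q)"
  by unfold_locales (simp_all add: S.add_left S.add_right S.scale_left S.scale_right
      H.add_left H.add_right H.scale_left H.scale_right algebra_simps)

text \<open>In the associator of \<open>S + H\<close> the terms with \<open>H\<close> twice cancel
  by associativity. By \<open>S_H\<close> the mixed terms, apart from \<open>S p (H q r)\<close>,
  reduce to \<open>H (S p q) r + H (S p r) q\<close>, which is symmetric in \<open>q\<close> and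
  \<open>r\<close>.\<close>

lemma pre_lie_iff: "pre_lie_algebra scalars L bullet \<longleftrightarrow> (\<forall>p q r. cls (defect p q r) = cls 0)"
proof -
  have "bullet (bullet (cls p) (cls q)) (cls r) \<ominus>\<^bsub>L\<^esub> bullet (cls p) (bullet (cls q) (cls r))
      = bullet (bullet (cls p) (cls r)) (cls q) \<ominus>\<^bsub>L\<^esub> bullet (cls p) (bullet (cls r) (cls q))
    \<longleftrightarrow> cls (defect p q r) = cls 0" for p q r
    unfolding cls_bullet cls_minus
    by (subst cls_eq_iff) (simp add: defect_def S.add_left S.add_right S.right.diff H.add_left
        H.add_right H_assoc S_H algebra_simps)
  then have "pre_lie_algebra_axioms L bullet \<longleftrightarrow> (\<forall>p q r. cls (defect p q r) = cls 0)"
    by (simp add: pre_lie_algebra_axioms_def all_carrier_iff)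
  then show ?thesis
    by (simp add: pre_lie_algebra_def bilinear_product_quotient[OF bilinear_S_plus_H cls_bullet])
qed

lemma lie_algebra_br: "lie_algebra scalars L br"
proof (intro lie_algebra.intro lie_algebra_axioms.intro)
  show "bilinear_product scalars L br"
    by (rule bilinear_product_quotient[OF bilinear_H_commutator cls_br])
qed (auto simp: carrier_eq cls_br cls_add zero_eq H.left.diff H.right.diff H_assoc)

text \<open>The axiom \<open>br_star\<close> is the derivation law for a commutator and follows from
  \<open>S_H\<close>; only \<open>star_br\<close> leaves a condition.\<close>

lemma post_lie_iff: "post_lie_algebra scalars L br star \<longleftrightarrow> (\<forall>p q r. cls (defect p q r) = cls 0)"
proof -
  have "star (cls p) (br (cls q) (cls r)) = star (star (cls p) (cls q)) (cls r)
      \<ominus>\<^bsub>L\<^esub> star (cls p) (star (cls q) (cls r)) \<ominus>\<^bsub>L\<^esub> star (star (cls p) (cls r)) (cls q)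
      \<oplus>\<^bsub>L\<^esub> star (cls p) (star (cls r) (cls q))
    \<longleftrightarrow> cls (defect p q r) = cls 0" for p q r
    unfolding cls_star cls_br cls_minus cls_add defect_def
    \<comment> \<open>Swapping the sides gives the difference the sign of
      \<open>defect\<close>.\<close>
    by (subst eq_commute, subst cls_eq_iff) simp
  then have "post_lie_algebra_axioms L br star \<longleftrightarrow> (\<forall>p q r. cls (defect p q r) = cls 0)"
    by (simp add: post_lie_algebra_axioms_def all_carrier_iff cls_br cls_star cls_add S_H S.left.diff
        algebra_simps)
  then show ?thesis
    by (simp add: post_lie_algebra_def lie_algebra_br
        bilinear_product_quotient[OF S.bilinear_map_axioms cls_star])
qed

end

section \<open>Products of tensor tuples\<close>

lemma sum_sum_delta_left:
  fixes f :: "'n::finite \<Rightarrow> 'n \<Rightarrow> 'b::comm_monoid_add"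
  shows "(\<Sum>i\<in>UNIV. \<Sum>j\<in>UNIV. if k = i then f i j else 0) = (\<Sum>j\<in>UNIV. f k j)"
  by (subst sum.swap) simp

section \<open>Tensor classes and well-defined products on them\<close>

context linear_space
begin

lemma mem_tensor_class: "q \<in> tensor_class scale p \<longleftrightarrow> p - q \<in> relators"
  by (simp add: tensor_class_def tensor_rel_def)

lemma tensor_class_eq_iff: "tensor_class scale p = tensor_class scale q \<longleftrightarrow> p - q \<in> relators"
proof
  assume "tensor_class scale p = tensor_class scale q"
  then have "q \<in> tensor_class scale p"
    by (simp add: mem_tensor_class free.span_zero)
  then show "p - q \<in> relators"
    by (simp only: mem_tensor_class)
next
  assume "p - q \<in> relators"
  then have "p - r \<in> relators \<longleftrightarrow> q - r \<in> relators" for r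
    using free.span_add_eq[of "p - q" _ "q - r"] by simp
  then show "tensor_class scale p = tensor_class scale q"
    by (simp add: set_eq_iff mem_tensor_class)
qed

lemma UN_tensor_class:
  assumes "\<And>q. p - q \<in> relators \<Longrightarrow> f q = f p"
  shows "(\<Union>q\<in>tensor_class scale p. f q) = f p"
proof -
  have "p \<in> tensor_class scale p" by (simp add: mem_tensor_class free.span_zero)
  moreover have "f q = f p" if "q \<in> tensor_class scale p" for q
    using assms that by (simp add: mem_tensor_class)
  ultimately show ?thesis by blast
qed

lemma UN_UN_tensor_class:
  assumes "\<And>p' q'. p - p' \<in> relators \<Longrightarrow> q - q' \<in> relators \<Longrightarrow> h p q - h p' q' \<in> relators"
  shows "(\<Union>p'\<in>tensor_class scale p. \<Union>q'\<in>tensor_class scale q. tensor_class scale (h p' q'))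
    = tensor_class scale (h p q)"
proof -
  have "p \<in> tensor_class scale p" "q \<in> tensor_class scale q"
    by (simp_all add: mem_tensor_class free.span_zero)
  moreover have "tensor_class scale (h p' q') = tensor_class scale (h p q)"
    if "p' \<in> tensor_class scale p" "q' \<in> tensor_class scale q" for p' q'
    using assms[of p' q'] that unfolding mem_tensor_class tensor_class_eq_iff[symmetric] by simp
  ultimately show ?thesis by blast
qed

text \<open>The two arguments are changed one after the other.\<close>

lemma bilinear_extension_congruent:
  assumes "\<And>r q. r \<in> relators \<Longrightarrow> bilinear_extension h r q \<in> relators"
    and "\<And>r q. r \<in> relators \<Longrightarrow> bilinear_extension h q r \<in> relators"
    and "p - p' \<in> relators" "q - q' \<in> relators"
  shows "bilinear_extension h p q - bilinear_extension h p' q' \<in> relators"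
proof -
  have "bilinear_extension h p q - bilinear_extension h p' q' =
    bilinear_extension h (p - p') q + bilinear_extension h p' (q - q')"
    by (simp add: free_linear)
  then show ?thesis using assms by (simp add: free.span_add)
qed

lemma quotient_space_tensors: "quotient_space free_scale (tensors scale) (tensor_class scale)"
proof
  show "carrier (tensors scale) = range (tensor_class scale)"
    by (auto simp: tensors_def quotient_def tensor_class_def)
  fix p q :: "'v list \<Rightarrow>\<^sub>0 'k" and c
  show "\<zero>\<^bsub>tensors scale\<^esub> = tensor_class scale 0"
    by (simp add: tensors_def)
  have "(p + q) - (p' + q') \<in> relators" if "p - p' \<in> relators" "q - q' \<in> relators" for p' q'
    using free.span_add[OF that] by (simp add: algebra_simps)
  then show "tensor_class scale p \<oplus>\<^bsub>tensors scale\<^esub> tensor_class scale q = tensor_class scale (p + q)"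
    by (simp add: tensors_def UN_UN_tensor_class)
  have "free_scale c q - free_scale c p \<in> relators" if "p - q \<in> relators" for q
    using free.span_neg[OF free.span_scale[OF that, of c]] by (simp add: algebra_simps)
  then show "c \<odot>\<^bsub>tensors scale\<^esub> tensor_class scale p = tensor_class scale (free_scale c p)"
    unfolding tensors_def by (simp, subst UN_tensor_class) (simp_all add: tensor_class_eq_iff)
qed

lemma mult_tensors:
  "tensor_class scale p \<otimes>\<^bsub>tensors scale\<^esub> tensor_class scale q = tensor_class scale (p \<diamondop> q)"
  by (simp add: tensors_def UN_UN_tensor_class bilinear_extension_congruent
      shuffle_relators_left shuffle_relators_right)

lemma star_tensor_class:
  assumes "Vector_Spaces.linear scale scale \<phi>"
  shows "star_tensor scale \<phi> (tensor_class scale p) (tensor_class scale q)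
    = tensor_class scale (star \<phi> p q)"
  by (simp add: star_tensor_def UN_UN_tensor_class bilinear_extension_congruent
      star_relators_left[OF _ assms] star_relators_right)

lemma quotient_space_space_of: "quotient_space scale (space_of scale) (\<lambda>x. x)"
  by unfold_locales (simp_all add: space_of_def)

end

section \<open>Lifting the products on tuples to representatives\<close>

locale tensor_tuple_products = linear_space scale
  for scale :: "'k::field \<Rightarrow> 'v::ab_group_add \<Rightarrow> 'v" +
  fixes F :: "'n::finite \<Rightarrow> 'v \<Rightarrow> 'v" and a :: "'n \<Rightarrow> 'k"
  assumes linear_F: "Vector_Spaces.linear scale scale (F i)"
begin

sublocale tensors: quotient_space free_scale "tensors scale" "tensor_class scale"
  by (rule quotient_space_tensors)

sublocale tuples: quotient_space "\<lambda>c p i. free_scale c (p i)" "tensor_tuples scale"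
    "\<lambda>p (i::'n). tensor_class scale (p i)"
  by (rule tensors.quotient_direct_power)

text \<open>The star keeps the index of its first factor, so coordinate \<open>k\<close> involves
  only \<open>p k\<close>; in \<open>shuffle_lift\<close> the index of the second factor is
  kept.\<close>

definition star_lift :: "('n \<Rightarrow> 'v list \<Rightarrow>\<^sub>0 'k) \<Rightarrow> ('n \<Rightarrow> 'v list \<Rightarrow>\<^sub>0 'k) \<Rightarrow> 'n \<Rightarrow> 'v list \<Rightarrow>\<^sub>0 'k" where
  "star_lift p q = (\<lambda>k. \<Sum>j\<in>UNIV. star (F j) (p k) (q j))"

definition shuffle_lift :: "('n \<Rightarrow> 'v list \<Rightarrow>\<^sub>0 'k) \<Rightarrow> ('n \<Rightarrow> 'v list \<Rightarrow>\<^sub>0 'k) \<Rightarrow> 'n \<Rightarrow> 'v list \<Rightarrow>\<^sub>0 'k" where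
  "shuffle_lift p q = (\<lambda>k. \<Sum>i\<in>UNIV. free_scale (a i) (p i \<diamondop> q k))"

abbreviation tuple_class :: "('n \<Rightarrow> 'v list \<Rightarrow>\<^sub>0 'k) \<Rightarrow> 'n \<Rightarrow> ('v, 'k) tensor" where
  "tuple_class p \<equiv> \<lambda>i. tensor_class scale (p i)"

lemma star_product_class:
  "star_product scale F (tuple_class p) (tuple_class q) = tuple_class (star_lift p q)"
proof -
  have "unit_tuple (tensors scale) i (star_tensor scale (F j) (tensor_class scale f) (tensor_class scale g))
      = (\<lambda>k. tensor_class scale (if k = i then star (F j) f g else 0))" for i j f g
    by (simp only: star_tensor_class linear_F tensors.cls_unit_tuple)
  then show ?thesis
    unfolding star_product_def star_lift_def
    by (subst tensors.cls_extend_product[where Q = "\<lambda>i j f g k. if k = i then star (F j) f g else 0"])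
      (simp_all only: sum_sum_delta_left)
qed

lemma a_smult_unit_tuple_class:
  "c \<odot>\<^bsub>tensor_tuples scale\<^esub> unit_tuple (tensors scale) j
      (tensor_class scale f \<otimes>\<^bsub>tensors scale\<^esub> tensor_class scale g)
    = (\<lambda>k. tensor_class scale (if k = (j::'n) then free_scale c (f \<diamondop> g) else 0))"
  unfolding mult_tensors tensors.cls_unit_tuple tuples.cls_smult
  by (rule ext) simp

lemma a_shuffle_class:
  "a_shuffle scale a (tuple_class p) (tuple_class q) = tuple_class (shuffle_lift p q)"
  unfolding a_shuffle_def shuffle_lift_def
  by (subst tensors.cls_extend_product
      [where Q = "\<lambda>i j f g k. if k = j then free_scale (a i) (f \<diamondop> g) else 0"])
    (simp_all add: a_smult_unit_tuple_class)

lemma bullet_product_class: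
  "bullet_product scale F a (tuple_class p) (tuple_class q)
    = tuple_class (star_lift p q + shuffle_lift p q)"
  by (simp only: bullet_product_def star_product_class a_shuffle_class tuples.cls_add)

lemma a_bracket_class:
  "a_bracket scale a (tuple_class p) (tuple_class q)
    = tuple_class (shuffle_lift p q - shuffle_lift q p)"
proof -
  let ?Q = "\<lambda>i j f g k. (if k = j then free_scale (a i) (f \<diamondop> g) else 0)
    - (if k = i then free_scale (a j) (f \<diamondop> g) else 0)"
  have "a i \<odot>\<^bsub>tensor_tuples scale\<^esub> unit_tuple (tensors scale) j
        (tensor_class scale f \<otimes>\<^bsub>tensors scale\<^esub> tensor_class scale g)
      \<ominus>\<^bsub>tensor_tuples scale\<^esub> a j \<odot>\<^bsub>tensor_tuples scale\<^esub> unit_tuple (tensors scale) i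
        (tensor_class scale f \<otimes>\<^bsub>tensors scale\<^esub> tensor_class scale g)
      = (\<lambda>k. tensor_class scale (?Q i j f g k))" for i j f g
    unfolding a_smult_unit_tuple_class tuples.cls_minus by (rule ext) simp
  then have product: "a_bracket scale a (tuple_class p) (tuple_class q)
      = (\<lambda>k. tensor_class scale (\<Sum>i\<in>UNIV. \<Sum>j\<in>UNIV. ?Q i j (p i) (q j) k))"
    unfolding a_bracket_def
    by (subst tensors.cls_extend_product[where Q = ?Q]) (simp_all only:)
  \<comment> \<open>Commutativity of the shuffle turns the subtracted half of the bracket into the
    opposite product.\<close>
  have "(\<Sum>j\<in>UNIV. free_scale (a j) (p k \<diamondop> q j)) = shuffle_lift q p k" for k
    by (simp add: shuffle_lift_def shuffle_commute[of "p k"])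
  then show ?thesis
    unfolding product sum_subtractf sum_sum_delta_left
    by (simp add: shuffle_lift_def)
qed

text \<open>Only the index of the last factor survives; the earlier ones contribute their weights,
  in either bracketing.\<close>

lemma shuffle_lift_assoc: "shuffle_lift (shuffle_lift p q) r = shuffle_lift p (shuffle_lift q r)"
proof
  fix k
  have "shuffle_lift (shuffle_lift p q) r k
      = (\<Sum>i\<in>UNIV. \<Sum>j\<in>UNIV. free_scale (a i * a j) (p j \<diamondop> (q i \<diamondop> r k)))"
    by (simp add: shuffle_lift_def free_linear free.scale_sum_right shuffle_assoc)
  also have "\<dots> = shuffle_lift p (shuffle_lift q r) k"
    by (subst sum.swap) (simp add: shuffle_lift_def free_linear free.scale_sum_right mult.commute)
  finally show "shuffle_lift (shuffle_lift p q) r k = shuffle_lift p (shuffle_lift q r) k" .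
qed

text \<open>The star preserves the index of its first factor, hence the weights \<open>a i\<close>,
  which reduces the claim to \<open>star_shuffle\<close>.\<close>

lemma star_lift_shuffle_lift:
  "star_lift (shuffle_lift p q) r = shuffle_lift (star_lift p r) q + shuffle_lift p (star_lift q r)"
proof
  fix k
  have "star_lift (shuffle_lift p q) r k = (\<Sum>i\<in>UNIV. \<Sum>j\<in>UNIV.
      free_scale (a i) (star (F j) (p i) (r j) \<diamondop> q k) + free_scale (a i) (p i \<diamondop> star (F j) (q k) (r j)))"
    unfolding star_lift_def shuffle_lift_def
    by (subst sum.swap) (simp add: free_linear star_shuffle algebra_simps)
  then show "star_lift (shuffle_lift p q) r k
      = (shuffle_lift (star_lift p r) q + shuffle_lift p (star_lift q r)) k"
    by (simp add: star_lift_def shuffle_lift_def free_linear free.scale_sum_right sum.distrib)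
qed

sublocale derivation_pair "\<lambda>c p i. free_scale c (p i)" "tensor_tuples scale" tuple_class
  star_lift shuffle_lift "star_product scale F" "a_bracket scale a" "bullet_product scale F a"
  by unfold_locales
    (simp_all add: star_lift_shuffle_lift shuffle_lift_assoc star_product_class
      a_bracket_class bullet_product_class,
     auto simp: star_lift_def shuffle_lift_def fun_eq_iff free_linear sum.distrib
      free.scale_sum_right mult.commute algebra_simps)

text \<open>Modulo relators this is the star for the endomorphism \<open>\<theta>\<close>. The four
  terms stay separate because equality with that single star holds only modulo relators.\<close>

definition letter_defect where
  "letter_defect i j p s = star (\<lambda>x. F j (F i x)) p s - star (\<lambda>x. F i (F j x)) p s
    - free_scale (a i) (star (F j) p s) + free_scale (a j) (star (F i) p s)"

lemma defect_eq:
  "defect p q r k = (\<Sum>i\<in>UNIV. \<Sum>j\<in>UNIV. letter_defect i j (p k) (q i \<diamondop> r j))"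
proof -
  \<comment> \<open>In all six expansions the indices are named so that \<open>i\<close> belongs to
    \<open>q\<close> and \<open>j\<close> to \<open>r\<close>. Then
    \<open>star_star_commutator\<close> applies termwise, with \<open>\<phi> = F i\<close> and
    \<open>\<psi> = F j\<close>.\<close>
  have 1: "star_lift (star_lift p q) r k = (\<Sum>i\<in>UNIV. \<Sum>j\<in>UNIV. star (F j) (star (F i) (p k) (q i)) (r j))"
    by (subst sum.swap) (simp add: star_lift_def free_linear)
  have 2: "star_lift p (star_lift q r) k = (\<Sum>i\<in>UNIV. \<Sum>j\<in>UNIV. star (F i) (p k) (star (F j) (q i) (r j)))"
    by (simp add: star_lift_def free_linear)
  have 3: "star_lift (star_lift p r) q k = (\<Sum>i\<in>UNIV. \<Sum>j\<in>UNIV. star (F i) (star (F j) (p k) (r j)) (q i))"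
    by (simp add: star_lift_def free_linear)
  have 4: "star_lift p (star_lift r q) k = (\<Sum>i\<in>UNIV. \<Sum>j\<in>UNIV. star (F j) (p k) (star (F i) (r j) (q i)))"
    by (subst sum.swap) (simp add: star_lift_def free_linear)
  have 5: "star_lift p (shuffle_lift q r) k = (\<Sum>i\<in>UNIV. \<Sum>j\<in>UNIV. free_scale (a i) (star (F j) (p k) (q i \<diamondop> r j)))"
    by (subst sum.swap) (simp add: star_lift_def shuffle_lift_def free_linear)
  have 6: "star_lift p (shuffle_lift r q) k = (\<Sum>i\<in>UNIV. \<Sum>j\<in>UNIV. free_scale (a j) (star (F i) (p k) (q i \<diamondop> r j)))"
    by (simp add: star_lift_def shuffle_lift_def free_linear shuffle_commute[of "r _"])
  have "defect p q r k = star_lift (star_lift p q) r k - star_lift p (star_lift q r) k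
      - star_lift (star_lift p r) q k + star_lift p (star_lift r q) k
      - (star_lift p (shuffle_lift q r) k - star_lift p (shuffle_lift r q) k)"
    by (simp add: defect_def S.right.diff)
  also have "\<dots> = (\<Sum>i\<in>UNIV. \<Sum>j\<in>UNIV. letter_defect i j (p k) (q i \<diamondop> r j))"
    unfolding 1 2 3 4 5 6 letter_defect_def star_star_commutator[symmetric] sum_subtractf[symmetric]
      sum.distrib[symmetric]
    by (simp add: algebra_simps)
  finally show ?thesis .
qed

text \<open>The module law of the Lie algebra for the basis vectors with indices \<open>j\<close>
  and \<open>i\<close>, in this order.\<close>

definition lie_relations :: bool where
  "lie_relations \<longleftrightarrow> (\<forall>i j x. F j (F i x) - F i (F j x) = scale (a i) (F j x) - scale (a j) (F i x))"

lemma letter_defect_relators: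
  assumes lie_relations shows "letter_defect i j p s \<in> relators"
proof -
  \<comment> \<open>Both sides are written as two-term combinations, so that the leading stars of
    two instances of \<open>star_combination\<close> cancel.\<close>
  have eq: "(\<lambda>x. scale 1 (F j (F i x)) + scale (- 1) (F i (F j x)))
      = (\<lambda>x. scale (a i) (F j x) + scale (- a j) (F i x))"
    using assms by (simp add: lie_relations_def)
  show ?thesis
    using free.span_diff[OF star_combination[of "a i" "F j" "- a j" "F i" p s]
        star_combination[of 1 "\<lambda>x. F j (F i x)" "- 1" "\<lambda>x. F i (F j x)" p s]]
    unfolding eq letter_defect_def by (simp add: algebra_simps)
qed

lemma star_letter: "star \<phi> (word [x]) (word []) = word [\<phi> x]"
  by (simp add: word_Cons star_prepend free_linear)

lemma defect_vanishes_iff: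
  "(\<forall>p q r. tuple_class (defect p q r) = tuple_class 0) \<longleftrightarrow> lie_relations"
proof
  assume lie_relations
  then show "\<forall>p q r. tuple_class (defect p q r) = tuple_class 0"
    by (simp add: fun_eq_iff tensor_class_eq_iff defect_eq free.span_sum letter_defect_relators)
next
  assume zero: "\<forall>p q r. tuple_class (defect p q r) = tuple_class 0"
  show lie_relations unfolding lie_relations_def
  proof (intro allI)
    fix i j x
    \<comment> \<open>Empty words at \<open>i\<close> and \<open>j\<close> isolate one pair of
      indices. The first argument may be a constant tuple, as coordinate \<open>i\<close> of the
      defect sees only its coordinate \<open>i\<close>.\<close>
    let ?e = "\<lambda>i l. if l = i then word [] else 0"
    have "letter_defect l m (word [x]) (?e i l \<diamondop> ?e j m)
        = (if m = j then if l = i then letter_defect i j (word [x]) (word []) else 0 else 0)" for l m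
      by (simp add: letter_defect_def free_linear)
    then have "defect (\<lambda>_. word [x]) (?e i) (?e j) i = letter_defect i j (word [x]) (word [])"
      by (simp add: defect_eq)
    with zero[rule_format, THEN fun_cong, of "\<lambda>_. word [x]" "?e i" "?e j" i]
    have "letter_defect i j (word [x]) (word []) \<in> relators"
      by (simp add: tensor_class_eq_iff)
    \<comment> \<open>The remaining element is a combination of one-letter words, so its degree-one
      part is the desired relation in \<open>V\<close>.\<close>
    from letter_part_relators[OF this]
    show "F j (F i x) - F i (F j x) = scale (a i) (F j x) - scale (a j) (F i x)"
      by (simp add: letter_defect_def star_letter letter_part.diff letter_part_add letter_part_scale
          letter_part_word algebra_simps)
  qed
qed

sublocale letters: quotient_space scale "space_of scale" "\<lambda>x. x"
  by (rule quotient_space_space_of)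

end

section \<open>The action on \<open>V\<close>\<close>

lemma quotient_space_scalars: "quotient_space (*) (scalars :: ('k::field, 'k) module) (\<lambda>x. x)"
proof -
  interpret vector_space "(*) :: 'k \<Rightarrow> 'k \<Rightarrow> 'k"
    by unfold_locales (simp_all add: algebra_simps)
  show ?thesis
    by unfold_locales simp_all
qed

lemma quotient_space_scalar_tuples:
  "quotient_space (\<lambda>c p i. c * p i) (direct_power scalars :: ('k::field, 'n::finite \<Rightarrow> 'k) module) (\<lambda>p. p)"
  using quotient_space.quotient_direct_power[OF quotient_space_scalars] .

text \<open>These are not obtained by interpretation, because the simplification rule
  \<open>scale a (scale b x) = scale (a * b) x\<close> loops together with \<open>mult_ac\<close> for the field itself.\<close>

lemmas scalar_tuples_simps =
  quotient_space.carrier_eq[OF quotient_space_scalar_tuples]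
  quotient_space.cls_add[OF quotient_space_scalar_tuples]
  quotient_space.zero_eq[OF quotient_space_scalar_tuples]
  quotient_space.cls_smult[OF quotient_space_scalar_tuples]
  quotient_space.cls_minus[OF quotient_space_scalar_tuples]

text \<open>With the linear form \<open>\<alpha>(c) = \<Sum>i. a i * c i\<close>, the bracket is
  \<open>\<alpha>(d) c - \<alpha>(c) d\<close>.\<close>

lemma ga_bracket_eq:
  "ga_bracket a c d = (\<lambda>k. (\<Sum>j\<in>UNIV. a j * d j) * c k - (\<Sum>i\<in>UNIV. a i * c i) * d k)"
proof -
  let ?Q = "\<lambda>i j f g k. (if k = i then f * g * a j else 0) - (if k = j then f * g * a i else 0)"
  have "(f * g) \<odot>\<^bsub>direct_power scalars\<^esub> (a j \<odot>\<^bsub>direct_power scalars\<^esub> unit_tuple scalars i 1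
      \<ominus>\<^bsub>direct_power scalars\<^esub> a i \<odot>\<^bsub>direct_power scalars\<^esub> unit_tuple scalars j 1)
      = ?Q i j f g" for i j f g
    unfolding unit_tuple_def scalars_simps scalar_tuples_simps
    by (simp add: fun_eq_iff)
  then have "ga_bracket a (\<lambda>i. c i) (\<lambda>i. d i) = (\<lambda>k. \<Sum>i\<in>UNIV. \<Sum>j\<in>UNIV. ?Q i j (c i) (d j) k)"
    unfolding ga_bracket_def
    by (subst quotient_space.cls_extend_product[OF quotient_space_scalars, where Q = ?Q]) (simp_all only:)
  then show ?thesis
    unfolding sum_subtractf sum_sum_delta_left by (simp add: sum_distrib_left mult_ac)
qed

text \<open>The form \<open>\<alpha>\<close> vanishes on brackets because its values
  commute.\<close>

lemma ga_bracket_functional: "(\<Sum>k\<in>UNIV. a k * ga_bracket a c d k) = 0"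
proof -
  have "(\<Sum>k\<in>UNIV. a k * ga_bracket a c d k) = (\<Sum>j\<in>UNIV. a j * d j) * (\<Sum>k\<in>UNIV. a k * c k)
      - (\<Sum>i\<in>UNIV. a i * c i) * (\<Sum>k\<in>UNIV. a k * d k)"
    by (simp add: ga_bracket_eq right_diff_distrib sum_subtractf mult.left_commute[of "a _"]
        flip: sum_distrib_left)
  then show ?thesis by simp
qed

lemma lie_algebra_ga: "lie_algebra scalars (direct_power scalars) (ga_bracket a)"
proof (intro lie_algebra.intro lie_algebra_axioms.intro)
  have "bilinear_map (\<lambda>c p i. c * p i) (ga_bracket a)"
    by unfold_locales
      (auto simp: ga_bracket_eq fun_eq_iff sum.distrib sum_distrib_left algebra_simps)
  then show "bilinear_product scalars (direct_power scalars) (ga_bracket a)"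
    by (rule quotient_space.bilinear_product_quotient[OF quotient_space_scalar_tuples]) simp
  show "ga_bracket a x x = \<zero>\<^bsub>direct_power scalars\<^esub>" for x
    by (simp add: scalar_tuples_simps ga_bracket_eq fun_eq_iff)
  fix x y z
  \<comment> \<open>One of the two terms drops out since \<open>\<alpha>\<close> kills the inner
    bracket; what remains cancels in the cyclic sum.\<close>
  have nested: "ga_bracket a x (ga_bracket a y z) = (\<lambda>k. - (\<Sum>i\<in>UNIV. a i * x i) * ga_bracket a y z k)" for x y z
    by (subst ga_bracket_eq) (simp add: ga_bracket_functional)
  show "ga_bracket a x (ga_bracket a y z) \<oplus>\<^bsub>direct_power scalars\<^esub>
      ga_bracket a y (ga_bracket a z x) \<oplus>\<^bsub>direct_power scalars\<^esub> ga_bracket a z (ga_bracket a x y)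
      = \<zero>\<^bsub>direct_power scalars\<^esub>"
    unfolding nested scalar_tuples_simps by (simp add: ga_bracket_eq fun_eq_iff algebra_simps)
qed

section \<open>The module law on basis vectors\<close>

context tensor_tuple_products
begin

lemma F_linear:
  "F i (x + y) = F i x + F i y" "F i (scale c x) = scale c (F i x)"
  "F i (\<Sum>k\<in>A. f k) = (\<Sum>k\<in>A. F i (f k))"
proof -
  interpret Fi: Vector_Spaces.linear scale scale "F i" by (rule linear_F)
  show "F i (x + y) = F i x + F i y" "F i (scale c x) = scale c (F i x)"
    "F i (\<Sum>k\<in>A. f k) = (\<Sum>k\<in>A. F i (f k))"
    by (simp_all add: Fi.add Fi.scale Fi.sum)
qed

text \<open>The coefficients \<open>c i * d j\<close> are those of \<open>action_commutator\<close>,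
  so the two sums can be compared term by term.\<close>

lemma action_bracket:
  "action scale F (ga_bracket a c d) v
    = (\<Sum>i\<in>UNIV. \<Sum>j\<in>UNIV. scale (c i * d j) (scale (a j) (F i v) - scale (a i) (F j v)))"
proof -
  have "(\<Sum>i\<in>UNIV. \<Sum>j\<in>UNIV. scale (c i * d j) (scale (a i) (F j v)))
      = (\<Sum>j\<in>UNIV. \<Sum>i\<in>UNIV. scale (a i * c i * d j) (F j v))"
    by (subst sum.swap) (simp add: mult_ac)
  then show ?thesis
    by (simp add: action_def ga_bracket_eq scale_left_diff_distrib scale_right_diff_distrib
        sum_subtractf sum_distrib_left scale_sum_left mult_ac)
qed

lemma action_commutator:
  "action scale F c (action scale F d v) - action scale F d (action scale F c v)
    = (\<Sum>i\<in>UNIV. \<Sum>j\<in>UNIV. scale (c i * d j) (F i (F j v) - F j (F i v)))"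
proof -
  have "action scale F d (action scale F c v) = (\<Sum>i\<in>UNIV. \<Sum>j\<in>UNIV. scale (c i * d j) (F j (F i v)))"
    by (subst sum.swap) (simp add: action_def F_linear scale_sum_right mult_ac)
  then show ?thesis
    by (simp add: action_def F_linear scale_sum_right scale_right_diff_distrib sum_subtractf)
qed

text \<open>The other module axioms follow from linearity of each \<open>F i\<close>, so only
  \<open>act_br\<close> gives a condition, and by bilinearity it is one on basis vectors.\<close>

lemma lie_module_iff:
  "lie_module scalars (direct_power scalars) (ga_bracket a) (space_of scale) (action scale F)
    \<longleftrightarrow> lie_relations"
proof -
  have "(\<forall>c d v. action scale F (ga_bracket a c d) v
      = action scale F c (action scale F d v) - action scale F d (action scale F c v))
    \<longleftrightarrow> lie_relations" (is "?A \<longleftrightarrow> _")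
  proof
    assume ?A
    show lie_relations unfolding lie_relations_def
    proof (intro allI)
      fix i j x
      \<comment> \<open>Basis vectors, used below in the order \<open>j\<close>, \<open>i\<close> to
        match the orientation of \<open>lie_relations\<close>.\<close>
      let ?e = "\<lambda>(i::'n) l. if l = i then 1 else 0 :: 'k"
      have delta: "(\<Sum>l\<in>UNIV. \<Sum>m\<in>UNIV. scale (?e j l * ?e i m) (f l m)) = f j i" for f
        by (simp add: if_distrib[of "\<lambda>c. scale c _"] if_distrib[of "\<lambda>c. _ * c"] cong: if_cong)
      have "action scale F (ga_bracket a (?e j) (?e i)) x
          = action scale F (?e j) (action scale F (?e i) x)
            - action scale F (?e i) (action scale F (?e j) x)"
        using \<open>?A\<close> by blast
      then show "F j (F i x) - F i (F j x) = scale (a i) (F j x) - scale (a j) (F i x)"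
        unfolding action_bracket action_commutator delta ..
    qed
  next
    assume lie_relations
    then show ?A
      by (simp add: action_bracket action_commutator lie_relations_def)
  qed
  moreover have "lie_module_axioms scalars (direct_power scalars) (ga_bracket a) (space_of scale)
      (action scale F) \<longleftrightarrow> ?A"
    by (simp add: lie_module_axioms_def scalar_tuples_simps letters.carrier_eq letters.cls_add letters.cls_smult letters.cls_minus
        action_def F_linear scale_sum_right sum.distrib scale_left_distrib scale_right_distrib mult.commute)
  ultimately show ?thesis
    by (simp add: lie_module_def lie_algebra_ga letters.vector_space_over_quotient)
qed

end

theorem theorem3:
  fixes scale :: "'k::field \<Rightarrow> 'v::ab_group_add \<Rightarrow> 'v"
    and F :: "'n::finite \<Rightarrow> 'v \<Rightarrow> 'v"
    and a :: "'n \<Rightarrow> 'k"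
  assumes "vector_space scale"
    and "\<And>i. Vector_Spaces.linear scale scale (F i)"
  shows "(pre_lie_algebra scalars (tensor_tuples scale) (bullet_product scale F a)
      \<longleftrightarrow> post_lie_algebra scalars (tensor_tuples scale) (a_bracket scale a) (star_product scale F))
    \<and> (post_lie_algebra scalars (tensor_tuples scale) (a_bracket scale a) (star_product scale F)
      \<longleftrightarrow> lie_module scalars (direct_power scalars) (ga_bracket a) (space_of scale) (action scale F))"
proof -
  interpret tensor_tuple_products scale F a
    by (intro tensor_tuple_products.intro linear_space.intro tensor_tuple_products_axioms.intro assms)
  show ?thesis
    by (simp only: pre_lie_iff post_lie_iff lie_module_iff defect_vanishes_iff)
qed

end
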